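(* Fix an integer $d \geq 2$ and $\lambda \in \mathbb{C}$. Then $-1 \notin \tilde{S}_\lambda(d)$ if and only if there is a convex set $T \subset \mathbb{C}$ with $0 \in T$ such that for every $w \in T$, the quantity $g(w) = \log(1 + \lambda e^{-dw})$ is well-defined (i.e. $\lambda e^{-dw} \neq -1$) and $g(w) \in T$.
   Context: Branch convention: for $z = \rho e^{\iota \vartheta}$ with $\rho>0$, $\vartheta \in (-\pi,\pi]$, $\log z = \log \rho + \iota\vartheta$ and $z^\delta = \rho^\delta e^{\iota\delta\vartheta}$ for $\delta > 0$ (with $0^0=1$); $\log 0$ is undefined. The set $\tilde{S}_\lambda(d) \subseteq \mathbb{C}$ is the set of points generated by the rules: (i) $0 \in \tilde{S}_\lambda(d)$; (ii) if $k \geq 1$, $z_1,\dots,z_k \in \tilde{S}_\lambda(d)$ with $z_i \neq -1$ for all $i$, and $\delta_1,\dots,\delta_k \geq 0$ with $\sum_i \delta_i \leq d$, then $\lambda / \prod_{i=1}^k (1+z_i)^{\delta_i}$ is in $\tilde{S}_\lambda(d)$. *)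

theory Defs
  imports "HOL-Analysis.Analysis"
begin

(* Ln and powr use the principal branch, with imaginary part of Ln in (-pi, pi].
   The library value 0 powr 0 = 0 plays no role here: every base 1 + z i is nonzero. *)
inductive_set S_tilde :: "complex \<Rightarrow> nat \<Rightarrow> complex set"
  for lam :: complex and d :: nat where
  zero: "0 \<in> S_tilde lam d"
| step: "\<lbrakk> (k :: nat) \<ge> 1;
           \<And>i. i \<in> {1..k} \<Longrightarrow> z i \<in> S_tilde lam d;
           \<And>i. i \<in> {1..k} \<Longrightarrow> z i \<noteq> -1;
           \<And>i. i \<in> {1..k} \<Longrightarrow> \<delta> i \<ge> 0;
           (\<Sum>i=1..k. \<delta> i :: real) \<le> real d \<rbrakk>
         \<Longrightarrow> lam / (\<Prod>i=1..k. (1 + z i) powr complex_of_real (\<delta> i)) \<in> S_tilde lam d"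

(* Since Ln is total, g_map lam d w is meaningful only if lam * exp (- d w) \<noteq> -1. *)
definition g_map :: "complex \<Rightarrow> nat \<Rightarrow> complex \<Rightarrow> complex" where
  "g_map lam d w = Ln (1 + lam * exp (- (of_nat d * w)))"

end

theory Submission
  imports Defs
begin

text \<open>
  In the coordinate \<open>w = Ln (1 + z)\<close> the generating rule of \<open>S_tilde lam d\<close> reads
  \<open>z = lam * exp (- (d * w))\<close> with \<open>w = (\<Sum>i. (\<delta> i / d) * Ln (1 + z i))\<close>, and such \<open>w\<close> are exactly
  the convex combinations of \<open>0 = Ln (1 + 0)\<close> and the \<open>Ln (1 + z i)\<close>. So if \<open>-1\<close> is not generated,
  the convex hull of all \<open>Ln (1 + z)\<close> is a suitable \<open>T\<close>; conversely, induction over the rules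
  keeps every \<open>Ln (1 + z)\<close> inside a given \<open>T\<close>.
\<close>

text \<open>For a nonzero base, \<open>powr\<close> is by definition \<open>exp\<close> of the
  exponent times the principal \<open>Ln\<close>. Only exponentials are merged and no logarithm of a
  product is taken, so no branch correction arises.\<close>

lemma prod_powr_eq_exp_sum:
  fixes x :: "'a \<Rightarrow> complex"
  assumes "finite A" and "\<And>i. i \<in> A \<Longrightarrow> x i \<noteq> 0"
  shows "(\<Prod>i\<in>A. x i powr a i) = exp (\<Sum>i\<in>A. a i * Ln (x i))"
  using assms by (simp add: exp_sum powr_def)

lemma convex_sum_with_zero:
  fixes y :: "nat \<Rightarrow> 'a::real_vector"
  assumes "convex T" "0 \<in> T"
    and "\<And>i. i \<in> {1..k} \<Longrightarrow> 0 \<le> a i"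
    and "sum a {1..k} \<le> 1"
    and "\<And>i. i \<in> {1..k} \<Longrightarrow> y i \<in> T"
  shows "(\<Sum>i=1..k. a i *\<^sub>R y i) \<in> T"
proof -
  \<comment> \<open>Index 0 lies outside \<open>{1..k}\<close>, so it is free to carry the missing
    weight, placed on the point 0 of \<open>T\<close>.\<close>
  define b where "b = a(0 := 1 - sum a {1..k})"
  define x where "x = y(0 := 0)"
  have b: "sum b {1..k} = sum a {1..k}"
    by (rule sum.cong) (auto simp: b_def)
  have x: "(\<Sum>i=1..k. b i *\<^sub>R x i) = (\<Sum>i=1..k. a i *\<^sub>R y i)"
    by (rule sum.cong) (auto simp: b_def x_def)
  have "(\<Sum>i\<in>{0..k}. b i *\<^sub>R x i) \<in> T"
  proof (rule convex_sum[OF _ \<open>convex T\<close>])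
    show "sum b {0..k} = 1"
      using b by (simp add: sum.atLeast_Suc_atMost b_def)
  qed (use assms in \<open>auto simp: b_def x_def\<close>)
  then show ?thesis
    using x by (simp add: sum.atLeast_Suc_atMost x_def)
qed

lemma S_tilde_invariant:
  assumes "d > 0" "convex T" "0 \<in> T"
    and T: "\<And>w. w \<in> T \<Longrightarrow> lam * exp (- (of_nat d * w)) \<noteq> -1 \<and> g_map lam d w \<in> T"
    and "z \<in> S_tilde lam d"
  shows "z \<noteq> -1 \<and> Ln (1 + z) \<in> T"
  using \<open>z \<in> S_tilde lam d\<close>
proof induction
  case zero
  then show ?case using \<open>0 \<in> T\<close> by simp
next
  case (step k z \<delta>)
  \<comment> \<open>The weights \<open>\<delta> i / d\<close> sum to at most 1, possibly less;
    \<open>0 \<in> T\<close> makes up the difference.\<close>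
  define w where "w = (\<Sum>i=1..k. (\<delta> i / d) *\<^sub>R Ln (1 + z i))"
  have "w \<in> T"
    unfolding w_def
    by (rule convex_sum_with_zero)
      (use step assms in \<open>auto simp: sum_divide_distrib[symmetric]\<close>)
  have "of_nat d * w = (\<Sum>i=1..k. of_real (\<delta> i) * Ln (1 + z i))"
    using \<open>d > 0\<close> by (simp add: w_def sum_distrib_left scaleR_conv_of_real)
  moreover have "(\<Prod>i=1..k. (1 + z i) powr of_real (\<delta> i))
      = exp (\<Sum>i=1..k. of_real (\<delta> i) * Ln (1 + z i))"
    by (rule prod_powr_eq_exp_sum) (use step in \<open>auto simp: add_eq_0_iff\<close>)
  ultimately have "lam / (\<Prod>i=1..k. (1 + z i) powr of_real (\<delta> i)) = lam * exp (- (of_nat d * w))"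
    by (simp add: exp_minus divide_inverse)
  then show ?case
    using T[OF \<open>w \<in> T\<close>] by (simp add: g_map_def)
qed

text \<open>Weights \<open>u i\<close> of a convex combination become exponents
  \<open>d * u i\<close> in the generating rule, with sum exactly \<open>d\<close>. The rule applies
  because no generated point is -1.\<close>

lemma S_tilde_exp_convex_hull:
  assumes "-1 \<notin> S_tilde lam d"
    and w: "w \<in> convex hull ((\<lambda>z. Ln (1 + z)) ` S_tilde lam d)"
  shows "lam * exp (- (of_nat d * w)) \<in> S_tilde lam d"
proof -
  obtain k u x where ux: "\<And>i. i \<in> {1..k::nat} \<Longrightarrow> 0 \<le> u i \<and> x i \<in> (\<lambda>z. Ln (1 + z)) ` S_tilde lam d"
    and u1: "sum u {1..k} = 1" and w_eq: "(\<Sum>i=1..k. u i *\<^sub>R x i) = w"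
    using w unfolding convex_hull_indexed by blast
  have "\<forall>i\<in>{1..k}. \<exists>z. z \<in> S_tilde lam d \<and> x i = Ln (1 + z)"
    using ux by blast
  then obtain z where z: "\<And>i. i \<in> {1..k} \<Longrightarrow> z i \<in> S_tilde lam d \<and> x i = Ln (1 + z i)"
    by metis
  have ne: "z i \<noteq> -1" if "i \<in> {1..k}" for i
    using z[OF that] assms(1) by metis
  have "k \<ge> 1"
    using u1 by (cases k) auto
  then have "lam / (\<Prod>i=1..k. (1 + z i) powr of_real (d * u i)) \<in> S_tilde lam d"
    by (rule S_tilde.step) (use z ne ux u1 in \<open>auto simp flip: sum_distrib_left\<close>)
  moreover have "(\<Prod>i=1..k. (1 + z i) powr of_real (d * u i))
      = exp (\<Sum>i=1..k. of_real (d * u i) * Ln (1 + z i))"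
    by (rule prod_powr_eq_exp_sum) (use ne in \<open>auto simp: add_eq_0_iff\<close>)
  moreover have "(\<Sum>i=1..k. of_real (d * u i) * Ln (1 + z i)) = of_nat d * w"
    using z by (auto simp: w_eq[symmetric] sum_distrib_left scaleR_conv_of_real mult_ac intro!: sum.cong)
  ultimately show ?thesis
    by (simp add: exp_minus divide_inverse)
qed

theorem theorem3p5:
  fixes d :: nat and lam :: complex
  assumes "d \<ge> 2"
  shows "-1 \<notin> S_tilde lam d \<longleftrightarrow>
    (\<exists>T :: complex set. convex T \<and> 0 \<in> T \<and>
      (\<forall>w\<in>T. lam * exp (- (of_nat d * w)) \<noteq> -1 \<and> g_map lam d w \<in> T))"
proof
  assume notin: "-1 \<notin> S_tilde lam d"
  define L where "L = (\<lambda>z. Ln (1 + z)) ` S_tilde lam d"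
  have "0 \<in> L"
    unfolding L_def using S_tilde.zero[of lam d] by (force simp: image_iff)
  moreover have "lam * exp (- (of_nat d * w)) \<noteq> -1 \<and> g_map lam d w \<in> convex hull L"
    if "w \<in> convex hull L" for w
  proof -
    have "lam * exp (- (of_nat d * w)) \<in> S_tilde lam d"
      using S_tilde_exp_convex_hull[OF notin] that by (simp add: L_def)
    \<comment> \<open>This generated point differs from -1, and its image under
      \<open>Ln (1 + z)\<close> is \<open>g_map lam d w\<close>, which therefore lies already in
      \<open>L\<close>.\<close>
    then show ?thesis
      using notin by (metis L_def g_map_def hull_inc image_eqI)
  qed
  ultimately show "\<exists>T. convex T \<and> 0 \<in> T \<and>
      (\<forall>w\<in>T. lam * exp (- (of_nat d * w)) \<noteq> -1 \<and> g_map lam d w \<in> T)"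
    by (intro exI[of _ "convex hull L"]) (simp add: hull_inc)
next
  assume "\<exists>T. convex T \<and> 0 \<in> T \<and>
      (\<forall>w\<in>T. lam * exp (- (of_nat d * w)) \<noteq> -1 \<and> g_map lam d w \<in> T)"
  \<comment> \<open>If -1 were generated, the invariant at \<open>z = -1\<close> would give
    \<open>-1 \<noteq> -1\<close>.\<close>
  then show "-1 \<notin> S_tilde lam d"
    using S_tilde_invariant[of d _ lam "-1"] assms by auto
qed

end
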